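(* Let $F\colon\mathbb{F}_{2^n}\to\mathbb{F}_{2^m}$ be a Boolean bent function. Then for any $a\in\mathbb{F}_{2^m}$ we have $$|F^{-1}(a)|=2^{n-m}+2^{n/2}-2^{n/2-m}(2k_a+1),$$ where $k_a=|\{b\in\mathbb{F}_{2^m}^*: W_F(b,0)=-2^{n/2}\cdot(-1)^{\operatorname{Tr}(ab)}\}|$, and all $k_a$ have the same parity.
   Context: $\operatorname{Tr}$ denotes the absolute trace to $\mathbb{F}_2$. The Walsh transform of $F\colon\mathbb{F}_{2^n}\to\mathbb{F}_{2^m}$ is $W_F(b,a)=\sum_{x\in\mathbb{F}_{2^n}}(-1)^{\operatorname{Tr}(bF(x))+\operatorname{Tr}(ax)}$ for $b\in\mathbb{F}_{2^m}$, $a\in\mathbb{F}_{2^n}$. $F$ is bent if $|W_F(b,a)|=2^{n/2}$ for all $b\in\mathbb{F}_{2^m}^*$ and all $a\in\mathbb{F}_{2^n}$. $F^{-1}(a)$ denotes the preimage set of $a$.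
   Formalization: The claim that all k_a have the same parity is stated only for m ≥ 2, since for m = 1 it fails for every bent function (k_0 + k_1 = 1); the formula for |F^{-1}(a)| is stated for all m. *)

theory Defs
  imports
    "HOL-Computational_Algebra.Primes"
    "HOL-Library.Cardinality"
    "HOL-Library.Discrete_Functions"
    "HOL-Library.Z2"
    Complex_Main
begin

text \<open>
  The field of order \<open>2^n\<close> is rendered as a type \<open>'a\<close> of class \<^class>\<open>finite_field\<close> with
  \<open>CARD('a) = 2 ^ n\<close>; its prime field is identified with the two-element field \<^typ>\<open>bit\<close>.
\<close>

text \<open>For a field of order \<open>2^n\<close> this is \<open>n\<close>, its degree over the two-element field.\<close>

definition bin_degree :: "'a :: finite_field itself \<Rightarrow> nat" where
  "bin_degree _ = floor_log CARD('a)"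

lemma bin_degree_eq:
  assumes "CARD('a :: finite_field) = 2 ^ n"
  shows "bin_degree TYPE('a) = n"
  using assms by (simp add: bin_degree_def)

definition trace_sum :: "'a :: finite_field \<Rightarrow> 'a" where
  "trace_sum x = (\<Sum>i<bin_degree TYPE('a). x ^ (2 ^ i))"

text \<open>
  The value of \<^const>\<open>trace_sum\<close> lies in the prime field \<open>{0, 1}\<close> of \<open>'a\<close>; the absolute trace is
  the same value read in \<^typ>\<open>bit\<close>, so that traces coming from two different fields can be added.
  The lemma \<open>of_bool_Tr\<close> below shows that no information is lost.
\<close>

definition Tr :: "'a :: finite_field \<Rightarrow> bit" where
  "Tr x = (if trace_sum x = 0 then 0 else 1)"

lemma CHAR_eq_2:
  assumes "CARD('a :: finite_field) = 2 ^ n"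
  shows "CHAR('a) = 2"
proof -
  have "(\<Sum>x\<in>UNIV. x + 1 :: 'a) = (\<Sum>x\<in>UNIV. x)"
    by (rule sum.reindex_bij_witness[of _ "\<lambda>x. x - 1" "\<lambda>x. x + 1"]) auto
  then have "of_nat CARD('a) = (0 :: 'a)"
    by (simp add: sum.distrib)
  then have "CHAR('a) dvd 2 ^ n"
    unfolding assms of_nat_eq_0_iff_char_dvd .
  then show ?thesis
    using CHAR_prime[where ?'a = 'a] prime_dvd_power primes_dvd_imp_eq two_is_prime_nat by blast
qed

lemma trace_sum_cases:
  fixes x :: "'a :: finite_field"
  assumes card: "CARD('a) = 2 ^ n"
  shows "trace_sum x = 0 \<or> trace_sum x = 1"
proof -
  have T: "trace_sum x = (\<Sum>i<n. x ^ (2 ^ i))"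
    unfolding trace_sum_def bin_degree_eq[OF card] ..
  have "trace_sum x ^ 2 = (\<Sum>i<n. (x ^ (2 ^ i)) ^ 2)"
    unfolding T
    using freshmans_dream_sum[where ?'a = 'a and A = "{..<n}" and f = "\<lambda>i. x ^ (2 ^ i)"]
    by (simp add: CHAR_eq_2[OF card])
  also have "\<dots> = (\<Sum>i<n. x ^ (2 ^ Suc i))"
    by (simp add: power_mult[symmetric] mult.commute)
  also have "\<dots> = (\<Sum>i<Suc n. x ^ (2 ^ i)) - x"
    by (subst sum.lessThan_Suc_shift) simp
  also have "\<dots> = trace_sum x"
    using finite_field_power_card_eq_same[of x] by (simp add: T card)
  finally have "trace_sum x * (trace_sum x - 1) = 0"
    by (simp add: power2_eq_square algebra_simps)
  then show ?thesis by simp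
qed

lemma of_bool_Tr:
  fixes x :: "'a :: finite_field"
  assumes "CARD('a) = 2 ^ n"
  shows "of_bool (Tr x = 1) = trace_sum x"
  using trace_sum_cases[OF assms, of x] by (auto simp: Tr_def)

text \<open>The power \<open>(-1)^t\<close> with an exponent in the two-element field.\<close>

definition neg_one_pow :: "bit \<Rightarrow> int" where
  "neg_one_pow t = (if t = 0 then 1 else - 1)"

definition Walsh :: "('a :: finite_field \<Rightarrow> 'b :: finite_field) \<Rightarrow> 'b \<Rightarrow> 'a \<Rightarrow> int" where
  "Walsh F b a = (\<Sum>x\<in>UNIV. neg_one_pow (Tr (b * F x) + Tr (a * x)))"

definition bent :: "('a :: finite_field \<Rightarrow> 'b :: finite_field) \<Rightarrow> bool" where
  "bent F \<longleftrightarrow> (\<forall>b a. b \<noteq> 0 \<longrightarrow>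
     \<bar>real_of_int (Walsh F b a)\<bar> = 2 powr (real (bin_degree TYPE('a)) / 2))"

definition k_num :: "('a :: finite_field \<Rightarrow> 'b :: finite_field) \<Rightarrow> 'b \<Rightarrow> nat" where
  "k_num F a = card {b. b \<noteq> 0 \<and> real_of_int (Walsh F b 0) =
     - (2 powr (real (bin_degree TYPE('a)) / 2)) * real_of_int (neg_one_pow (Tr (a * b)))}"

text \<open>
  Over a codomain with two elements the numbers \<open>k_num F a\<close> never have the same parity, so a claim of
  equal parities needs a codomain of order at least \<open>4\<close>.
\<close>

lemma k_num_degree_one:
  fixes F :: "'a :: finite_field \<Rightarrow> 'b :: finite_field"
  assumes card: "CARD('b) = 2" and bent: "bent F"
  shows "k_num F 0 + k_num F 1 = 1"
proof -
  define c where "c = (2 :: real) powr (real (bin_degree TYPE('a)) / 2)"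
  define w where "w = real_of_int (Walsh F 1 0)"
  have "c > 0" by (simp add: c_def)
  have w: "w = c \<or> w = - c"
    using bent unfolding bent_def c_def w_def by (metis abs_eq_iff' zero_neq_one)
  have "card {0, 1 :: 'b} = CARD('b)" by (simp add: card)
  then have U: "(UNIV :: 'b set) = {0, 1}"
    by (metis card_subset_eq finite_class.finite_UNIV subset_UNIV)
  then have nz: "b \<noteq> 0 \<longleftrightarrow> b = 1" for b :: 'b
    by (metis UNIV_I empty_iff insert_iff zero_neq_one)
  have deg: "bin_degree TYPE('b) = 1"
    by (rule bin_degree_eq) (simp add: card)
  have "Tr (0 :: 'b) = 0" "Tr (1 :: 'b) = 1"
    by (simp_all add: Tr_def trace_sum_def deg)
  then have "k_num F 0 = card {b :: 'b. b = 1 \<and> w = - c}"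
    and "k_num F 1 = card {b :: 'b. b = 1 \<and> w = c}"
    unfolding k_num_def nz c_def w_def neg_one_pow_def
    by (auto intro!: arg_cong[of _ _ card])
  with w \<open>c > 0\<close> show ?thesis by auto
qed

end

theory Submission
  imports Defs "HOL-Computational_Algebra.Polynomial"
begin

text \<open>
  Inverting the Walsh transform over the additive characters of the codomain gives
  \<open>2^m |F\<^sup>-\<^sup>1(a)| = \<Sum>b. (-1)^Tr(ab) W(b,0)\<close>. The term \<open>b = 0\<close> equals \<open>2^n\<close>, and each of the
  other \<open>2^m - 1\<close> terms is \<open>\<plusminus>2^(n/2)\<close>, the sign being negative for exactly \<open>k_a\<close> of them. Hence
  also \<open>(-1)^k_a\<close> is the product of the signs of \<open>W(b,0)\<close> over \<open>b \<noteq> 0\<close> times the product of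
  all \<open>(-1)^Tr(ab)\<close>. The latter is \<open>1\<close> for \<open>m \<ge> 2\<close>, because \<open>b \<mapsto> Tr(ab)\<close> is either zero or takes
  the value \<open>1\<close> exactly \<open>2^(m-1)\<close> times; so the parity of \<open>k_a\<close> does not depend on \<open>a\<close>.
\<close>

lemma neg_one_pow_add: "neg_one_pow (s + t) = neg_one_pow s * neg_one_pow t"
  by (cases s; cases t) (simp_all add: neg_one_pow_def)

lemma neg_one_pow_0 [simp]: "neg_one_pow 0 = 1"
  by (simp add: neg_one_pow_def)

lemma Tr_0 [simp]: "Tr 0 = 0"
  by (simp add: Tr_def trace_sum_def power_0_left)

lemma trace_sum_add:
  fixes x y :: "'a :: finite_field"
  assumes "CARD('a) = 2 ^ n"
  shows "trace_sum (x + y) = trace_sum x + trace_sum y"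
proof -
  have "(x + y) ^ 2 ^ i = x ^ 2 ^ i + y ^ 2 ^ i" for i
    using freshmans_dream'[where ?'a = 'a, of "2 ^ i" i x y] by (simp add: CHAR_eq_2[OF assms])
  then show ?thesis
    by (simp add: trace_sum_def sum.distrib)
qed

lemma Tr_add:
  fixes x y :: "'a :: finite_field"
  assumes "CARD('a) = 2 ^ n"
  shows "Tr (x + y) = Tr x + Tr y"
proof -
  \<comment> \<open>When both traces are 1, the sum in the field has to vanish as it does in
    \<open>bit\<close>.\<close>
  have "(1 :: 'a) + 1 = 0"
    using of_nat_CHAR[where ?'a = 'a] by (simp add: CHAR_eq_2[OF assms])
  then show ?thesis
    using trace_sum_cases[OF assms, of x] trace_sum_cases[OF assms, of y]
    by (auto simp: Tr_def trace_sum_add[OF assms])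
qed

text \<open>As a polynomial function, the trace has degree \<open>2^(n-1) < 2^n\<close>, so it cannot vanish everywhere.\<close>

lemma Tr_nonzero:
  assumes card: "CARD('a :: finite_field) = 2 ^ n"
  obtains z :: "'a :: finite_field" where "Tr z = 1"
proof -
  have "n \<noteq> 0"
  proof
    assume "n = 0"
    then have "card {0, 1 :: 'a} \<le> 1"
      using card card_mono[of "UNIV :: 'a set" "{0, 1}"] by simp
    then show False by simp
  qed
  then obtain k where n: "n = Suc k" by (cases n) auto
  define p :: "'a poly" where "p = (\<Sum>i<n. monom 1 (2 ^ i))"
  \<comment> \<open>The exponents \<open>2 ^ i\<close> are pairwise distinct, so no other term can
    cancel the monomial with \<open>i = k\<close>.\<close>
  have "coeff p (2 ^ k) = (\<Sum>i<n. if i = k then 1 else 0)"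
    by (auto simp: p_def coeff_sum intro!: sum.cong)
  then have "p \<noteq> 0"
    using n by auto
  have "degree p \<le> 2 ^ k"
    unfolding p_def n
    by (intro degree_sum_le) (auto intro!: order.trans[OF degree_monom_le] power_increasing)
  have "card {x. poly p x = 0} \<le> degree p"
    by (rule card_poly_roots_bound) fact
  also have "\<dots> < CARD('a)"
    using \<open>degree p \<le> 2 ^ k\<close> by (simp add: card n less_le_trans le_less_trans)
  finally have "{x. poly p x = 0} \<noteq> UNIV" by auto
  then obtain z where "poly p z \<noteq> 0" by auto
  then have "Tr z = 1"
    by (simp add: p_def poly_sum poly_monom Tr_def trace_sum_def bin_degree_eq[OF card])
  then show ?thesis by (rule that)
qed

text \<open>Orthogonality of characters: for \<open>a \<noteq> 0\<close> choose \<open>c\<close>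
  with \<open>Tr (a * c) = 1\<close>. Translating \<open>b\<close> by \<open>c\<close> permutes the
  field and flips every sign, so the sum equals its own negative.\<close>

lemma sum_neg_one_pow_Tr:
  fixes a :: "'a :: finite_field"
  assumes card: "CARD('a) = 2 ^ n"
  shows "(\<Sum>b\<in>UNIV. neg_one_pow (Tr (a * b))) = (if a = 0 then 2 ^ n else 0)"
proof (cases "a = 0")
  case True
  then show ?thesis by (simp add: card)
next
  case False
  obtain z :: 'a where z: "Tr z = 1" using Tr_nonzero[OF card] .
  define c where "c = z / a"
  have "a * c = z" using False by (simp add: c_def)
  have "(\<Sum>b\<in>UNIV. neg_one_pow (Tr (a * b))) = (\<Sum>b\<in>UNIV. neg_one_pow (Tr (a * (b + c))))"
    by (rule sum.reindex_bij_witness[of _ "\<lambda>b. b + c" "\<lambda>b. b - c"]) auto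
  also have "\<dots> = (\<Sum>b\<in>UNIV. neg_one_pow (Tr (a * b)) * neg_one_pow 1)"
    by (simp only: distrib_left Tr_add[OF card] neg_one_pow_add \<open>a * c = z\<close> z)
  also have "\<dots> = - (\<Sum>b\<in>UNIV. neg_one_pow (Tr (a * b)))"
    by (simp add: neg_one_pow_def[of 1] sum_negf)
  finally show ?thesis using False by simp
qed

lemma prod_signs:
  fixes f :: "'a \<Rightarrow> 'b :: {comm_ring_1, ring_char_0}"
  assumes "finite A" and "\<And>x. x \<in> A \<Longrightarrow> f x = 1 \<or> f x = - 1"
  shows "(\<Prod>x\<in>A. f x) = (- 1) ^ card {x \<in> A. f x = - 1}"
proof -
  have "(\<Prod>x\<in>A. f x) = (\<Prod>x\<in>A. if f x = - 1 then - 1 else 1)"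
    using assms(2) by (intro prod.cong) auto
  also have "\<dots> = (\<Prod>x\<in>{x \<in> A. f x = - 1}. - 1)"
    using assms(1) by (rule prod.inter_filter[symmetric])
  finally show ?thesis by simp
qed

text \<open>Each sign is 1 minus a correction of 2 where it is -1. Like \<open>prod_signs\<close>,
  this is applied both to integer characters and to real normalized Walsh values.\<close>

lemma sum_signs:
  fixes f :: "'a \<Rightarrow> 'b :: {comm_ring_1, ring_char_0}"
  assumes "finite A" and "\<And>x. x \<in> A \<Longrightarrow> f x = 1 \<or> f x = - 1"
  shows "(\<Sum>x\<in>A. f x) = of_nat (card A) - 2 * of_nat (card {x \<in> A. f x = - 1})"
proof -
  have "(\<Sum>x\<in>A. f x) = (\<Sum>x\<in>A. 1 - (if f x = - 1 then 2 else 0))"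
    using assms(2) by (intro sum.cong) auto
  also have "\<dots> = of_nat (card A) - (\<Sum>x\<in>{x \<in> A. f x = - 1}. 2)"
    by (simp only: sum_subtractf sum.inter_filter[OF assms(1)] sum_constant[of 1] mult_1_right)
  finally show ?thesis by (simp add: mult.commute)
qed

lemma prod_neg_one_pow_Tr:
  fixes a :: "'a :: finite_field"
  assumes card: "CARD('a) = 2 ^ n" and "n \<ge> 2"
  shows "(\<Prod>b\<in>UNIV. neg_one_pow (Tr (a * b))) = 1"
proof (cases "a = 0")
  case True
  then show ?thesis by simp
next
  case False
  define k where "k = card {b \<in> UNIV. neg_one_pow (Tr (a * b)) = - 1}"
  have sign: "neg_one_pow t = 1 \<or> neg_one_pow t = - 1" for t
    by (simp add: neg_one_pow_def)
  have "0 = (2 :: int) ^ n - 2 * int k"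
    using sum_signs[of UNIV "\<lambda>b. neg_one_pow (Tr (a * b))"] sign False
    unfolding k_def by (simp add: sum_neg_one_pow_Tr[OF card] card)
  \<comment> \<open>The balance of signs gives \<open>2 * k = 2 ^ n\<close>, and splitting off two
    factors of 2 shows that \<open>k\<close> is even. For \<open>n = 1\<close> the count would be
    1.\<close>
  moreover obtain j where "n = j + 2"
    using \<open>n \<ge> 2\<close> le_Suc_ex by (metis add.commute)
  ultimately have "int k = 2 * 2 ^ j" by simp
  then have "even k" by (metis dvd_triv_left even_of_nat)
  then show ?thesis
    using prod_signs[of UNIV "\<lambda>b. neg_one_pow (Tr (a * b))"] sign
    unfolding k_def by simp
qed

lemma sum_Walsh:
  fixes F :: "'a :: finite_field \<Rightarrow> 'b :: finite_field"
  assumes card: "CARD('b) = 2 ^ m"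
  shows "(\<Sum>b\<in>UNIV. neg_one_pow (Tr (a * b)) * Walsh F b 0) = 2 ^ m * int (card (F -` {a}))"
proof -
  \<comment> \<open>In characteristic 2, \<open>a + F x\<close> plays the role of
    \<open>F x - a\<close>, so orthogonality picks out the fibre over \<open>a\<close>.\<close>
  have char2: "a + y = 0 \<longleftrightarrow> y = a" for y
  proof -
    have "of_nat 2 = (0 :: 'b)"
      using of_nat_CHAR[where ?'a = 'b] by (simp add: CHAR_eq_2[OF card])
    then have "a + a = 0" by (simp add: mult_2[symmetric])
    then show ?thesis by (metis add_left_cancel)
  qed
  have "(\<Sum>b\<in>UNIV. neg_one_pow (Tr (a * b)) * Walsh F b 0) =
      (\<Sum>b\<in>UNIV. \<Sum>x\<in>UNIV. neg_one_pow (Tr ((a + F x) * b)))"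
    by (simp add: Walsh_def sum_distrib_left distrib_left Tr_add[OF card] neg_one_pow_add
        mult.commute del: add_bit_eq_xor)
  also have "\<dots> = (\<Sum>x\<in>UNIV. \<Sum>b\<in>UNIV. neg_one_pow (Tr ((a + F x) * b)))"
    by (rule sum.swap)
  also have "\<dots> = (\<Sum>x\<in>UNIV. if F x = a then 2 ^ m else 0)"
    by (simp add: sum_neg_one_pow_Tr[OF card] char2)
  also have "\<dots> = (\<Sum>x\<in>{x \<in> UNIV. F x = a}. 2 ^ m)"
    by (rule sum.inter_filter[symmetric]) simp
  finally show ?thesis
    by (simp add: vimage_def)
qed

theorem theorem4p8:
  fixes F :: "'a :: finite_field \<Rightarrow> 'b :: finite_field" and n m :: nat
  assumes "CARD('a) = 2 ^ n" and "CARD('b) = 2 ^ m" and "bent F"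
  shows "(\<forall>a. real (card (F -` {a})) =
            2 powr (real n - real m) + 2 powr (real n / 2)
              - 2 powr (real n / 2 - real m) * (2 * real (k_num F a) + 1))
       \<and> (m \<ge> 2 \<longrightarrow> (\<forall>a a'. even (k_num F a) \<longleftrightarrow> even (k_num F a')))"
proof -
  define s where "s = (2 :: real) powr (real n / 2)"
  define \<chi> :: "'b \<Rightarrow> 'b \<Rightarrow> real" where "\<chi> a b = real_of_int (neg_one_pow (Tr (a * b)))" for a b
  \<comment> \<open>Bentness makes \<open>w b\<close> a sign for \<open>b \<noteq> 0\<close> only,
    hence the index set \<open>- {0}\<close> below.\<close>
  define w :: "'b \<Rightarrow> real" where "w b = real_of_int (Walsh F b 0) / s" for b
  have "s > 0" by (simp add: s_def)
  have w: "w b = 1 \<or> w b = - 1" if "b \<noteq> 0" for b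
  proof -
    have "\<bar>real_of_int (Walsh F b 0)\<bar> = s"
      using assms(3) that by (simp add: bent_def s_def bin_degree_eq[OF assms(1)])
    then show ?thesis using \<open>s > 0\<close> by (auto simp: w_def abs_if field_simps split: if_splits)
  qed
  have \<chi>: "\<chi> a b = 1 \<or> \<chi> a b = - 1" for a b
    by (simp add: \<chi>_def neg_one_pow_def)
  have sign: "\<chi> a b * w b = 1 \<or> \<chi> a b * w b = - 1" if "b \<in> - {0}" for a b
    using w[of b] \<chi>[of a b] that by auto
  have k: "k_num F a = card {b \<in> - {0}. \<chi> a b * w b = - 1}" for a
  proof -
    \<comment> \<open>A sign is its own inverse, so \<open>w b = - \<chi> a b\<close> can be
      multiplied by \<open>\<chi> a b\<close>.\<close>
    have "real_of_int (Walsh F b 0) = - s * \<chi> a b \<longleftrightarrow> \<chi> a b * w b = - 1" for b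
      using \<open>s > 0\<close> \<chi>[of a b] by (auto simp: w_def field_simps)
    then show ?thesis
      by (simp add: k_num_def bin_degree_eq[OF assms(1)] s_def \<chi>_def)
  qed
  have "real (card (F -` {a})) = 2 powr (real n - real m) + 2 powr (real n / 2)
      - 2 powr (real n / 2 - real m) * (2 * real (k_num F a) + 1)" for a
  proof -
    have "real (card (- {0 :: 'b})) = 2 ^ m - 1"
      by (simp add: Compl_eq_Diff_UNIV assms(2) of_nat_diff)
    then have *: "(\<Sum>b\<in>- {0}. \<chi> a b * w b) = 2 ^ m - 1 - 2 * real (k_num F a)"
      using sum_signs[of "- {0}" "\<lambda>b. \<chi> a b * w b", OF _ sign] by (simp add: k)
    have "2 ^ m * real (card (F -` {a})) = (\<Sum>b\<in>UNIV. \<chi> a b * real_of_int (Walsh F b 0))"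
      using arg_cong[OF sum_Walsh[OF assms(2), of a F], of real_of_int] by (simp add: \<chi>_def)
    also have "\<dots> = 2 ^ n + (\<Sum>b\<in>- {0}. \<chi> a b * real_of_int (Walsh F b 0))"
      by (subst sum.remove[of _ 0]) (simp_all add: \<chi>_def Walsh_def assms(1) Compl_eq_Diff_UNIV)
    also have "(\<Sum>b\<in>- {0}. \<chi> a b * real_of_int (Walsh F b 0)) = s * (\<Sum>b\<in>- {0}. \<chi> a b * w b)"
      using \<open>s > 0\<close> by (simp add: w_def sum_distrib_left)
    finally have "real (card (F -` {a})) = (2 ^ n + s * (2 ^ m - 1 - 2 * real (k_num F a))) / 2 ^ m"
      unfolding * by (simp add: field_simps)
    also have "\<dots> = 2 ^ n / 2 ^ m + s - s / 2 ^ m * (2 * real (k_num F a) + 1)"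
      by (simp add: add_divide_distrib diff_divide_distrib algebra_simps)
    finally have "real (card (F -` {a})) =
        2 ^ n / 2 ^ m + s - s / 2 ^ m * (2 * real (k_num F a) + 1)" .
    then show ?thesis
      by (simp only: powr_diff powr_realpow s_def zero_less_numeral)
  qed
  moreover have "even (k_num F a) \<longleftrightarrow> even (k_num F a')" if "m \<ge> 2" for a a'
  proof -
    \<comment> \<open>The right-hand side is independent of \<open>a\<close>, which is what yields
      equal parities.\<close>
    have "(- 1) ^ k_num F a = (\<Prod>b\<in>- {0}. w b)" for a
    proof -
      \<comment> \<open>Including \<open>b = 0\<close> contributes only the factor
        \<open>\<chi> a 0 = 1\<close>.\<close>
      have "(\<Prod>b\<in>- {0}. \<chi> a b) = (\<Prod>b\<in>UNIV. \<chi> a b)"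
        by (rule prod.mono_neutral_left) (auto simp: \<chi>_def)
      also have "\<dots> = 1"
        using arg_cong[OF prod_neg_one_pow_Tr[OF assms(2) that, of a], of real_of_int]
        by (simp add: \<chi>_def)
      finally show ?thesis
        using prod_signs[of "- {0}" "\<lambda>b. \<chi> a b * w b", OF _ sign] by (simp add: k prod.distrib)
    qed
    then have "(- 1 :: real) ^ k_num F a = (- 1) ^ k_num F a'" by simp
    then show ?thesis by (metis minus_one_power_iff one_neq_neg_one)
  qed
  ultimately show ?thesis by blast
qed

end
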